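(* For every $c\in(0,1]$ and every $q\in(0,1)$ with $q>e^{-c}$, the $c$-thinned $q$-quantile share is not universally feasible.
   Context: Let $[m]=\{1,\dots,m\}$ be a set of indivisible goods and $n\ge 2$ the number of agents. A monotone valuation on $[m]$ is a function $v:2^{[m]}\to\mathbb{R}_{\ge 0}$ with $v(\emptyset)=0$ and $v(A)\le v(B)$ whenever $A\subseteq B$. An allocation is an $n$-tuple $(S_1,\dots,S_n)$ of pairwise disjoint (possibly empty) subsets of $[m]$ whose union is $[m]$. For $c\in(0,1]$, the $c$-thinned random bundle $X^{(c)}\subseteq[m]$ is obtained by including each good independently with probability $c/n$. For $q\in(0,1)$, the $c$-thinned $q$-quantile share is $\tau_q^{(c)}(v,n):=\min\{t\in v(2^{[m]}):\mathbb{P}[v(X^{(c)})\le t]\ge q\}$. A share $\tau$ is universally feasible if for every profile $(v_1,\dots,v_n)$ of monotone valuations (any number of agents $n\ge 2$, any finite set of goods $[m]$) there is an allocation $(S_1,\dots,S_n)$ with $v_i(S_i)\ge\tau(v_i,n)$ for all $i\in[n]$. *)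

theory Defs
  imports "HOL-Probability.Probability"
begin

text \<open>
  The goods are \<open>{1..m}\<close> and the agents are \<open>{1..n}\<close>. Valuations are extensional on
  \<open>Pow {1..m}\<close>, so that they correspond exactly to functions on the bundles of \<open>{1..m}\<close>.
\<close>

definition monotone_valuation :: "nat \<Rightarrow> (nat set \<Rightarrow> real) \<Rightarrow> bool" where
  "monotone_valuation m v \<longleftrightarrow>
     v \<in> Pow {1..m} \<rightarrow>\<^sub>E {0..} \<and> v {} = 0 \<and>
     (\<forall>A B. A \<subseteq> B \<and> B \<subseteq> {1..m} \<longrightarrow> v A \<le> v B)"

definition allocation :: "nat \<Rightarrow> nat \<Rightarrow> (nat \<Rightarrow> nat set) \<Rightarrow> bool" where
  "allocation m n S \<longleftrightarrow> disjoint_family_on S {1..n} \<and> (\<Union>i\<in>{1..n}. S i) = {1..m}"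

definition thinned_bundle :: "real \<Rightarrow> nat \<Rightarrow> nat \<Rightarrow> nat set pmf" where
  "thinned_bundle c m n =
     map_pmf (\<lambda>b. {g \<in> {1..m}. b g})
       (Pi_pmf {1..m} False (\<lambda>_. bernoulli_pmf (c / real n)))"

text \<open>
  A share is a function of the number of goods \<open>m\<close>, the valuation and the number of agents;
  \<open>m\<close> is an explicit argument because a HOL function does not carry its domain.
  For \<open>q \<le> 1\<close> and a monotone valuation, the set below is finite and contains \<open>v {1..m}\<close>,
  so \<open>Min\<close> is a genuine minimum.
\<close>

definition thinned_quantile_share ::
    "real \<Rightarrow> real \<Rightarrow> nat \<Rightarrow> (nat set \<Rightarrow> real) \<Rightarrow> nat \<Rightarrow> real" where
  "thinned_quantile_share c q m v n =
     Min {t \<in> v ` Pow {1..m}.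
            measure_pmf.prob (thinned_bundle c m n) {X. v X \<le> t} \<ge> q}"

definition universally_feasible ::
    "(nat \<Rightarrow> (nat set \<Rightarrow> real) \<Rightarrow> nat \<Rightarrow> real) \<Rightarrow> bool" where
  "universally_feasible \<tau> \<longleftrightarrow>
     (\<forall>n\<ge>2. \<forall>m. \<forall>v :: nat \<Rightarrow> nat set \<Rightarrow> real.
        (\<forall>i\<in>{1..n}. monotone_valuation m (v i)) \<longrightarrow>
        (\<exists>S. allocation m n S \<and> (\<forall>i\<in>{1..n}. v i (S i) \<ge> \<tau> m (v i) n)))"

end

theory Submission
  imports Defs
begin

text \<open>
  Too few goods defeat the share. Give all \<open>n\<close> agents the same valuation on \<open>n - 1\<close> goods,
  worth \<open>1\<close> on every nonempty bundle and \<open>0\<close> on the empty one. The random bundle is worth \<open>0\<close>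
  exactly when it misses every good, which has probability \<open>(1 - c / n) ^ (n - 1)\<close>. This tends
  to \<open>exp (- c) < q\<close>, so for large \<open>n\<close> the value \<open>0\<close> falls short of the \<open>q\<close>-quantile and the
  share is \<open>1\<close>. Every agent must then receive a nonempty bundle, and \<open>n\<close> disjoint nonempty
  bundles do not fit into \<open>n - 1\<close> goods.
\<close>

definition unit_demand :: "nat \<Rightarrow> nat set \<Rightarrow> real" where
  "unit_demand m = (\<lambda>X\<in>Pow {1..m}. if X = {} then 0 else 1)"

lemma unit_demand_simps:
  assumes "X \<subseteq> {1..m}"
  shows "unit_demand m X = (if X = {} then 0 else 1)"
  using assms by (simp add: unit_demand_def)

lemma monotone_valuation_unit_demand: "monotone_valuation m (unit_demand m)"
  unfolding monotone_valuation_def unit_demand_def by auto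

text \<open>
  Passing to the independent coin flips disposes of sets outside \<open>Pow {1..m}\<close>, where an
  extensional valuation has no meaningful value.
\<close>

lemma prob_thinned_bundle:
  "measure_pmf.prob (thinned_bundle c m n) {X. P X} =
   measure_pmf.prob (Pi_pmf {1..m} False (\<lambda>_. bernoulli_pmf (c / real n)))
     {b. P {g \<in> {1..m}. b g}}"
  unfolding thinned_bundle_def by (simp add: vimage_def)

lemma prob_thinned_bundle_empty:
  assumes "0 \<le> c" "c \<le> real n"
  shows "measure_pmf.prob (thinned_bundle c m n) {X. X = {}} = (1 - c / real n) ^ m"
proof -
  have "{b. {g \<in> {1..m}. b g} = {}} = Pi {1..m} (\<lambda>_. {False})"
    by auto
  moreover have "0 \<le> c / real n" "c / real n \<le> 1"
    using assms by (auto simp: divide_le_eq_1)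
  ultimately show ?thesis
    unfolding prob_thinned_bundle by (simp add: measure_Pi_pmf_Pi measure_pmf_single)
qed

text \<open>
  The only possible shares are \<open>0\<close> and \<open>1\<close>, and \<open>0\<close> is excluded once the empty bundle has
  probability below \<open>q\<close>.
\<close>

lemma thinned_quantile_share_unit_demand:
  assumes "0 \<le> c" "c \<le> real n" "q \<le> 1" "0 < m" "(1 - c / real n) ^ m < q"
  shows "thinned_quantile_share c q m (unit_demand m) n = 1"
proof -
  let ?P = "\<lambda>t. measure_pmf.prob (thinned_bundle c m n) {X. unit_demand m X \<le> t}"
  have range_values: "unit_demand m ` Pow {1..m} = {0, 1}"
  proof
    show "unit_demand m ` Pow {1..m} \<subseteq> {0, 1}"
      by (auto simp: unit_demand_simps)
    have "unit_demand m {} = 0" "unit_demand m {1..m} = 1"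
      using \<open>0 < m\<close> by (simp_all add: unit_demand_simps)
    then show "{0, 1} \<subseteq> unit_demand m ` Pow {1..m}"
      by (metis Pow_bottom Pow_top empty_subsetI image_eqI insert_subset)
  qed
  have value_eq: "unit_demand m {g \<in> {1..m}. b g} = (if {g \<in> {1..m}. b g} = {} then 0 else 1)" for b
    by (rule unit_demand_simps) auto
  have iverson: "((if Q then 0 else 1 :: real) \<le> 1) = True" "((if Q then 0 else 1 :: real) \<le> 0) = Q" for Q
    by auto
  have "?P 1 = 1"
    unfolding prob_thinned_bundle value_eq iverson by simp
  moreover have "?P 0 < q"
  proof -
    have "?P 0 = measure_pmf.prob (thinned_bundle c m n) {X. X = {}}"
      unfolding prob_thinned_bundle value_eq iverson ..
    then show ?thesis
      using assms by (simp only: prob_thinned_bundle_empty)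
  qed
  ultimately have "{t \<in> unit_demand m ` Pow {1..m}. q \<le> ?P t} = {1}"
    unfolding range_values using \<open>q \<le> 1\<close> by auto
  then show ?thesis
    unfolding thinned_quantile_share_def by simp
qed

lemma allocation_nonempty_imp_le:
  assumes "allocation m n S" "\<And>i. i \<in> {1..n} \<Longrightarrow> S i \<noteq> {}"
  shows "n \<le> m"
proof -
  define f where "f i = (SOME x. x \<in> S i)" for i
  have f: "f i \<in> S i" if "i \<in> {1..n}" for i
    using assms(2)[OF that] by (simp add: f_def some_in_eq)
  have disj: "disjoint_family_on S {1..n}" and union: "(\<Union>i\<in>{1..n}. S i) = {1..m}"
    using assms(1) by (simp_all add: allocation_def)
  have "inj_on f {1..n}"
  proof (rule inj_onI, rule ccontr)
    fix i j assume ij: "i \<in> {1..n}" "j \<in> {1..n}" "f i = f j" "i \<noteq> j"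
    then have "S i \<inter> S j = {}"
      using disj by (meson disjoint_family_onD)
    then show False
      using f[OF ij(1)] f[OF ij(2)] ij(3) by auto
  qed
  moreover have "f ` {1..n} \<subseteq> {1..m}"
    using f union by blast
  ultimately have "card {1..n} \<le> card {1..m}"
    by (intro card_inj_on_le) auto
  then show ?thesis
    by simp
qed

text \<open>
  Having one good fewer than agents divides the standard exponential sequence by the factor
  \<open>1 - c / n\<close>, which tends to \<open>1\<close>.
\<close>

lemma tendsto_thinned_empty_prob:
  "(\<lambda>n. (1 - c / real n) ^ (n - 1)) \<longlonglongrightarrow> exp (- c)"
proof -
  have "(\<lambda>n. (1 + (- c) / real n) ^ n) \<longlonglongrightarrow> exp (- c)"
    by (rule tendsto_exp_limit_sequentially)
  moreover have base: "(\<lambda>n. 1 - c / real n) \<longlonglongrightarrow> 1"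
    using tendsto_diff[OF tendsto_const[of 1] lim_const_over_n[of c]] by simp
  ultimately have "(\<lambda>n. (1 - c / real n) ^ n / (1 - c / real n)) \<longlonglongrightarrow> exp (- c) / 1"
    by (intro tendsto_divide) auto
  moreover have "\<forall>\<^sub>F n in sequentially.
      (1 - c / real n) ^ n / (1 - c / real n) = (1 - c / real n) ^ (n - 1)"
    using order_tendstoD(1)[OF base zero_less_one] eventually_gt_at_top[of 0]
  proof eventually_elim
    case (elim n)
    then show ?case
      by (cases n) auto
  qed
  ultimately show ?thesis
    by (simp add: Lim_transform_eventually)
qed

theorem proposition1p8:
  fixes c q :: real
  assumes "0 < c" and "c \<le> 1"
    and "0 < q" and "q < 1"
    and "q > exp (- c)"
  shows "\<not> universally_feasible (thinned_quantile_share c q)"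
proof
  assume feasible: "universally_feasible (thinned_quantile_share c q)"
  have "\<forall>\<^sub>F n in sequentially. (1 - c / real n) ^ (n - 1) < q \<and> 2 \<le> n"
    using order_tendstoD(2)[OF tendsto_thinned_empty_prob \<open>q > exp (- c)\<close>]
      eventually_ge_at_top[of 2]
    by eventually_elim simp
  then obtain n :: nat where n: "(1 - c / real n) ^ (n - 1) < q" "2 \<le> n"
    by (auto simp: eventually_sequentially)
  define m where "m = n - 1"
  have share: "thinned_quantile_share c q m (unit_demand m) n = 1"
    using n assms by (intro thinned_quantile_share_unit_demand) (auto simp: m_def)
  obtain S where S: "allocation m n S"
      and "\<forall>i\<in>{1..n}. thinned_quantile_share c q m (unit_demand m) n \<le> unit_demand m (S i)"
    using feasible[unfolded universally_feasible_def, rule_format, of n m "\<lambda>_. unit_demand m"]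
      n(2) monotone_valuation_unit_demand by blast
  then have "S i \<noteq> {}" if "i \<in> {1..n}" for i
    using that share unit_demand_simps[of "{}" m] by fastforce
  then have "n \<le> m"
    by (rule allocation_nonempty_imp_le[OF S])
  then show False
    using n(2) by (simp add: m_def)
qed

end
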